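(* Let $n$ be a natural number with $n=5$ or $n>6$. Then any $n$-point set in $\mathbb{Z}^2$ is uniquely determined by its X-rays taken from at least $n$ different directions. That is, if $m\geq n$, $s_1,\dots,s_m$ are pairwise linearly independent directions, and $F,F'\subseteq\mathbb{Z}^2$ are $n$-point sets that have the same X-rays in each of the directions $s_1,\dots,s_m$, then $F=F'$.
   Context: A direction is a nonzero vector $s\in\mathbb{R}^2$; directions are regarded as different if they are linearly independent. For a finite set $F\subseteq\mathbb{Z}^2$, the (discrete) X-ray of $F$ in direction $s$ is the function that assigns to each line parallel to $s$ the number of points of $F$ on that line. *)

theory Defs
  imports "HOL-Analysis.Analysis"
begin

definition int_lattice :: "(real ^ 2) set" where
  "int_lattice = {x. \<forall>i. x $ i \<in> \<int>}"

definition direction :: "real ^ 2 \<Rightarrow> bool" where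
  "direction s \<longleftrightarrow> s \<noteq> 0"

text \<open>The conjunct \<open>s \<noteq> t\<close> is needed because \<open>{s, t}\<close> is a set and collapses to a singleton
  (independent for nonzero \<open>s\<close>) when the two vectors coincide.\<close>

definition different_directions :: "real ^ 2 \<Rightarrow> real ^ 2 \<Rightarrow> bool" where
  "different_directions s t \<longleftrightarrow> s \<noteq> t \<and> independent {s, t}"

definition lines_parallel_to :: "real ^ 2 \<Rightarrow> (real ^ 2) set set" where
  "lines_parallel_to s = {L. \<exists>p. L = {p + c *\<^sub>R s | c. c \<in> (UNIV :: real set)}}"

text \<open>The X-ray is a function on the set of lines parallel to \<open>s\<close> only; \<open>restrict\<close> makes equality
  of X-rays mean agreement on exactly those lines.\<close>

definition xray :: "real ^ 2 \<Rightarrow> (real ^ 2) set \<Rightarrow> (real ^ 2) set \<Rightarrow> nat" where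
  "xray s F = (\<lambda>L\<in>lines_parallel_to s. card (F \<inter> L))"

end

theory Submission
  imports Defs
begin

text \<open>Suppose \<open>F \<noteq> F'\<close>. Take a point \<open>p\<close> of \<open>F\<close> outside \<open>F'\<close>. On the line through \<open>p\<close> in each of
  the directions there must be a point of \<open>F' - F\<close>, and these points are distinct for distinct
  directions. As there are at least \<open>n\<close> directions and only \<open>n\<close> points in \<open>F'\<close>, there are exactly
  \<open>n\<close> directions, \<open>F\<close> and \<open>F'\<close> are disjoint, and every line in one of the directions that meets
  \<open>V = F \<union> F'\<close> contains exactly one point of each set (\<open>unique_partner\<close>). What remains is a
  statement about \<open>2 n\<close> points \<open>V\<close> and \<open>n\<close> directions, each of which matches \<open>V\<close> perfectly; this
  is the locale \<open>matched_by_directions\<close>.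

  In each direction both supporting lines of \<open>V\<close> contain two points of \<open>V\<close>. This gives \<open>2 n\<close>
  edges of the convex hull, which has at most \<open>2 n\<close> vertices; so \<open>V\<close> is the vertex set of a
  convex \<open>2 n\<close>-gon whose edges all have one of the given directions (\<open>hull_edge_from_and_to\<close>). Number
  the vertices \<open>v\<^sub>0, v\<^sub>1, \<dots>\<close> cyclically. Sweeping from the edge \<open>v\<^sub>i v\<^sub>i\<^sub>+\<^sub>1\<close> into the polygon, the
  lines parallel to that edge meet \<open>V\<close> in the pairs \<open>v\<^sub>i\<^sub>-\<^sub>k, v\<^sub>i\<^sub>+\<^sub>k\<^sub>+\<^sub>1\<close> one after the other
  (\<open>hull_walk_levels\<close>).

  Parallelism of the chords for \<open>k = 1\<close> and \<open>k = 2\<close> makes the edge vectors \<open>e\<^sub>i\<close> satisfy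
  \<open>e\<^sub>i\<^sub>+\<^sub>2 + e\<^sub>i\<^sub>-\<^sub>2 = t e\<^sub>i\<close> with one constant \<open>t\<close> (\<open>step_recurrence\<close>). If \<open>V\<close> consists of lattice
  points, the cross products of a fixed \<open>e\<^sub>i\<close> with \<open>e\<^sub>i, e\<^sub>i\<^sub>+\<^sub>2, e\<^sub>i\<^sub>+\<^sub>4, \<dots>\<close> form a bounded integer
  solution of the scalar recurrence. This forces \<open>t\<close> to be an integer with absolute value at
  most \<open>1\<close>, as in the crystallographic restriction (\<open>bounded_int_recurrence\<close>); hence \<open>e\<^sub>i\<close> is
  parallel to \<open>e\<^sub>i\<^sub>+\<^sub>4\<close> or to \<open>e\<^sub>i\<^sub>+\<^sub>6\<close>. But in a \<open>2 n\<close>-gon as above, two edges are parallel only if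
  their positions differ by a multiple of \<open>n\<close>, and \<open>n\<close> divides neither \<open>4\<close> nor \<open>6\<close>.\<close>
section \<open>The planar cross product\<close>

definition cross2 :: "real ^ 2 \<Rightarrow> real ^ 2 \<Rightarrow> real" where
  "cross2 x y = x $ 1 * y $ 2 - x $ 2 * y $ 1"

lemma cross2_simps [simp]:
  "cross2 (x + y) z = cross2 x z + cross2 y z"
  "cross2 (x - y) z = cross2 x z - cross2 y z"
  "cross2 z (x + y) = cross2 z x + cross2 z y"
  "cross2 z (x - y) = cross2 z x - cross2 z y"
  "cross2 (c *\<^sub>R x) z = c * cross2 x z"
  "cross2 z (c *\<^sub>R x) = c * cross2 z x"
  "cross2 (- x) z = - cross2 x z" "cross2 z (- x) = - cross2 z x"
  "cross2 x x = 0" "cross2 0 x = 0" "cross2 x 0 = 0"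
  by (simp_all add: cross2_def algebra_simps)

lemma cross2_commute: "cross2 y x = - cross2 x y"
  by (simp add: cross2_def algebra_simps)

lemma cross2_eq_0_imp_scaleR:
  assumes "cross2 x y = 0" "x \<noteq> 0"
  shows "\<exists>c. y = c *\<^sub>R x"
proof (cases "x $ 1 = 0")
  case True
  then have "x $ 2 \<noteq> 0" using assms(2) by (auto simp: vec_eq_iff forall_2)
  then have "y = (y $ 2 / x $ 2) *\<^sub>R x"
    using assms(1) True by (auto simp: vec_eq_iff forall_2 cross2_def)
  then show ?thesis by blast
next
  case False
  then have "y = (y $ 1 / x $ 1) *\<^sub>R x"
    using assms(1) by (auto simp: vec_eq_iff forall_2 cross2_def field_simps)
  then show ?thesis by blast
qed

lemma cross2_eq_0_trans:
  assumes "cross2 x y = 0" "cross2 y z = 0" "y \<noteq> 0"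
  shows "cross2 x z = 0"
proof -
  obtain c where "z = c *\<^sub>R y" using cross2_eq_0_imp_scaleR assms by blast
  then show ?thesis using assms(1) by simp
qed

text \<open>Cramer's rule: the coordinates of \<open>x\<close> with respect to \<open>e\<close> and \<open>f\<close>, without the division by
  the determinant.\<close>
lemma cross2_expand:
  "cross2 e f *\<^sub>R x = cross2 x f *\<^sub>R e + cross2 e x *\<^sub>R f"
  by (simp add: vec_eq_iff forall_2 cross2_def algebra_simps)

lemma different_directions_imp_cross2:
  assumes "direction s" "different_directions s t"
  shows "cross2 s t \<noteq> 0"
proof
  assume "cross2 s t = 0"
  then obtain c where c: "t = c *\<^sub>R s"
    using cross2_eq_0_imp_scaleR assms(1) unfolding direction_def by blast
  have "independent {t, s}" "s \<noteq> t"
    using assms(2) unfolding different_directions_def by (auto simp: insert_commute)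
  then have "t \<notin> span {s}"
    by (simp add: independent_insert)
  then show False using c by (simp add: span_base span_mul)
qed

lemma cross2_int_lattice_diff:
  assumes "a \<in> int_lattice" "b \<in> int_lattice" "c \<in> int_lattice" "d \<in> int_lattice"
  shows "cross2 (a - b) (c - d) \<in> \<int>"
  using assms unfolding int_lattice_def cross2_def by (auto intro!: Ints_diff Ints_mult)

section \<open>Bounded integer solutions of a linear recurrence\<close>

text \<open>As \<open>c 2 = t * c 1\<close>, the number \<open>t\<close> is rational; write \<open>t = p / q\<close> in lowest terms. The recurrence shows that \<open>q\<close> divides every term; the
  quotients satisfy the same recurrence, so every power of \<open>q\<close> divides every term and \<open>q = 1\<close>.
  If the integer \<open>t\<close> had absolute value at least \<open>2\<close>, the sequence would grow at least linearly.
  The remaining values give \<open>c 2 = t * c 1\<close> and \<open>c 3 = (t\<^sup>2 - 1) * c 1\<close>.\<close>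
lemma bounded_int_recurrence:
  fixes c :: "nat \<Rightarrow> int" and t :: real
  assumes rec: "\<And>j. of_int (c (j + 2)) = t * of_int (c (j + 1)) - of_int (c j)"
    and c0: "c 0 = 0" and c1: "c 1 \<noteq> 0" and fin: "finite (range c)"
  shows "c 2 = 0 \<or> c 3 = 0"
proof -
  have c2: "real_of_int (c 2) = t * c 1" using rec[of 0] c0 by (simp add: numeral_2_eq_2)
  define r :: rat where "r = of_int (c 2) / of_int (c 1)"
  obtain p q where pq: "quotient_of r = (p, q)" by (cases "quotient_of r")
  have q: "q > 0" and cop: "coprime p q"
    using quotient_of_denom_pos[OF pq] quotient_of_coprime[OF pq] by auto
  have "t = of_rat r" using c2 c1 unfolding r_def by (simp add: of_rat_divide)
  then have t: "t = of_int p / of_int q"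
    unfolding quotient_of_div[OF pq] by (simp add: of_rat_divide)
  have qrec: "q * c (j + 2) = p * c (j + 1) - q * c j" for j
  proof -
    have "real_of_int (q * c (j + 2)) = real_of_int (p * c (j + 1) - q * c j)"
      using rec[of j] t q by (simp add: field_simps)
    then show ?thesis by linarith
  qed
  have pow: "q ^ k dvd c j" for k j
  proof (induction k arbitrary: j)
    case (Suc k)
    show ?case
    proof (cases j)
      case (Suc i)
      obtain a b d where abd: "c i = q ^ k * a" "c (i + 1) = q ^ k * b" "c (i + 2) = q ^ k * d"
        using Suc.IH by (meson dvd_def)
      then have "q ^ k * (q * d) = q ^ k * (p * b - q * a)"
        using qrec[of i] by (simp add: algebra_simps)
      then have "q * d = p * b - q * a" using q by simp
      then have "p * b = q * (d + a)" by (simp add: algebra_simps)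
      then have "q dvd b" using cop
        by (metis coprime_commute coprime_dvd_mult_right_iff dvd_triv_left)
      then show ?thesis using abd(2) Suc by (auto simp: mult_ac elim!: dvdE)
    qed (use c0 in simp)
  qed simp
  have "q = 1"
  proof (rule ccontr)
    assume "q \<noteq> 1"
    then have q2: "2 \<le> q" using q by linarith
    define k where "k = nat \<bar>c 1\<bar>"
    have "q ^ k \<le> \<bar>c 1\<bar>" using dvd_imp_le_int[OF c1 pow[of k 1]] q by simp
    moreover have "int k < 2 ^ k" by (metis of_nat_less_two_power)
    moreover have "(2::int) ^ k \<le> q ^ k" using q2 by (intro power_mono) auto
    ultimately show False unfolding k_def by linarith
  qed
  then have prec: "c (j + 2) = p * c (j + 1) - c j" for j using qrec[of j] by simp
  have "\<bar>p\<bar> \<le> 1"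
  proof (rule ccontr)
    assume p: "\<not> \<bar>p\<bar> \<le> 1"
    have grow: "\<bar>c (Suc j)\<bar> \<ge> \<bar>c j\<bar> + 1" for j
    proof (induction j)
      case (Suc j)
      have "\<bar>p * c (j + 1)\<bar> \<ge> 2 * \<bar>c (j + 1)\<bar>"
        unfolding abs_mult using p by (intro mult_right_mono) auto
      then show ?case using prec[of j] Suc by simp
    qed (use c0 c1 in simp)
    have lower: "\<bar>c j\<bar> \<ge> int j" for j
    proof (induction j)
      case (Suc j) then show ?case using grow[of j] by simp
    qed simp
    have "finite (abs ` range c)" using fin by simp
    then obtain B where "\<forall>x\<in>abs ` range c. x \<le> B" by (meson bdd_above.unfold bdd_above_finite)
    then have "\<bar>c (nat (B + 1))\<bar> \<le> B" and "\<bar>c 0\<bar> \<le> B" by auto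
    then show False using lower[of "nat (B + 1)"] by simp
  qed
  then consider "p = 0" | "p = 1" | "p = -1" by linarith
  then show ?thesis
    using prec[of 0] prec[of 1] c0 by cases (simp_all add: numeral_2_eq_2 numeral_3_eq_3)
qed

section \<open>Point sets perfectly matched by every direction\<close>

locale matched_by_directions =
  fixes V :: "(real ^ 2) set" and n :: nat and s :: "nat \<Rightarrow> real ^ 2"
  assumes finite_V: "finite V" and card_V: "card V = 2 * n" and n_ge_2: "2 \<le> n"
    and cross_s: "\<And>i j. i \<in> {1..n} \<Longrightarrow> j \<in> {1..n} \<Longrightarrow> i \<noteq> j \<Longrightarrow> cross2 (s i) (s j) \<noteq> 0"
    and match: "\<And>i v. i \<in> {1..n} \<Longrightarrow> v \<in> V \<Longrightarrow> \<exists>!u. u \<in> V \<and> u \<noteq> v \<and> cross2 (s i) (u - v) = 0"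
begin

lemma s_nonzero:
  assumes "i \<in> {1..n}" shows "s i \<noteq> 0"
proof -
  define j :: nat where "j = (if i = 1 then 2 else 1)"
  have "j \<in> {1..n}" "i \<noteq> j" using n_ge_2 by (auto simp: j_def)
  then have "cross2 (s i) (s j) \<noteq> 0" by (rule cross_s[OF assms])
  then show ?thesis by auto
qed

text \<open>An edge of the convex hull with direction \<open>s i\<close>, oriented counterclockwise: \<open>V\<close> lies to its
  left.\<close>

definition hull_edge :: "nat \<Rightarrow> real ^ 2 \<Rightarrow> real ^ 2 \<Rightarrow> bool" where
  "hull_edge i u v \<longleftrightarrow> i \<in> {1..n} \<and> u \<in> V \<and> v \<in> V \<and> u \<noteq> v \<and> cross2 (s i) (v - u) = 0
     \<and> (\<forall>w\<in>V. 0 \<le> cross2 (v - u) (w - u))"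

lemma hull_edgeD:
  assumes "hull_edge i u v"
  shows "i \<in> {1..n}" "u \<in> V" "v \<in> V" "u \<noteq> v" "cross2 (s i) (v - u) = 0"
    "\<And>w. w \<in> V \<Longrightarrow> 0 \<le> cross2 (v - u) (w - u)"
  using assms unfolding hull_edge_def by auto

lemma hull_edge_parallel_iff:
  assumes "hull_edge i u v"
  shows "cross2 (v - u) x = 0 \<longleftrightarrow> cross2 (s i) x = 0"
proof
  assume "cross2 (v - u) x = 0"
  then show "cross2 (s i) x = 0"
    using cross2_eq_0_trans[OF hull_edgeD(5)[OF assms]] hull_edgeD(4)[OF assms] by simp
next
  have "cross2 (v - u) (s i) = 0"
    using hull_edgeD(5)[OF assms] cross2_commute[of "s i"] by simp
  moreover assume "cross2 (s i) x = 0"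
  ultimately show "cross2 (v - u) x = 0"
    using cross2_eq_0_trans s_nonzero hull_edgeD(1)[OF assms] by blast
qed

lemma hull_edge_same_direction:
  assumes "hull_edge i u v" "hull_edge j u' v'" "cross2 (v - u) (v' - u') = 0"
  shows "i = j"
proof -
  have "cross2 (s i) (v' - u') = 0" using assms hull_edge_parallel_iff by blast
  then have "cross2 (v' - u') (s i) = 0" using cross2_commute[of "v' - u'"] by simp
  then have "cross2 (s j) (s i) = 0" using assms(2) hull_edge_parallel_iff by blast
  then show ?thesis using cross_s hull_edgeD(1) assms by blast
qed

lemma match_unique:
  assumes "i \<in> {1..n}" "v \<in> V" "u \<in> V" "u' \<in> V" "u \<noteq> v" "u' \<noteq> v"
    "cross2 (s i) (u - v) = 0" "cross2 (s i) (u' - v) = 0"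
  shows "u = u'"
  using match[OF assms(1,2)] assms by blast

text \<open>If two hull edges leave \<open>u\<close>, then the far end of each lies weakly to the left of the other, so
  their vectors are parallel, the directions agree, and the partner of \<open>u\<close> is unique.\<close>
lemma hull_edge_source_unique:
  assumes "hull_edge i u v" "hull_edge j u v'"
  shows "i = j \<and> v = v'"
proof -
  have "0 \<le> cross2 (v - u) (v' - u)" "0 \<le> cross2 (v' - u) (v - u)"
    by (rule hull_edgeD(6)[OF assms(1) hull_edgeD(3)[OF assms(2)]],
        rule hull_edgeD(6)[OF assms(2) hull_edgeD(3)[OF assms(1)]])
  then have "cross2 (v - u) (v' - u) = 0" using cross2_commute[of "v - u" "v' - u"] by simp
  then have "i = j" using hull_edge_same_direction assms by blast
  moreover have "v = v'"
    using match_unique[of i u v v'] assms hull_edgeD \<open>i = j\<close> by metis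
  ultimately show ?thesis by simp
qed

lemma hull_edge_target_unique:
  assumes "hull_edge i u v" "hull_edge j u' v"
  shows "i = j \<and> u = u'"
proof -
  have "0 \<le> cross2 (v - u) (u' - u)" "0 \<le> cross2 (v - u') (u - u')"
    by (rule hull_edgeD(6)[OF assms(1) hull_edgeD(2)[OF assms(2)]],
        rule hull_edgeD(6)[OF assms(2) hull_edgeD(2)[OF assms(1)]])
  moreover have "cross2 (v - u) (u' - u) = - cross2 (v - u) (v - u')"
    "cross2 (v - u') (u - u') = cross2 (v - u) (v - u')"
    by (simp_all add: cross2_commute[of u v] cross2_commute[of u' u])
  ultimately have "cross2 (v - u) (v - u') = 0" by simp
  then have "i = j" using hull_edge_same_direction assms by blast
  have "cross2 (s i) (u - v) = 0" "cross2 (s i) (u' - v) = 0"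
    using hull_edgeD(5)[OF assms(1)] hull_edgeD(5)[OF assms(2)] \<open>i = j\<close> by simp_all
  then have "u = u'"
    using match_unique[of i v u u'] assms hull_edgeD \<open>i = j\<close> by metis
  then show ?thesis using \<open>i = j\<close> by simp
qed

text \<open>A point of \<open>V\<close> on a supporting line has its partner on the same line. The sign \<open>\<sigma>\<close> selects
  one of the two supporting lines; the edge on it is traversed along \<open>\<sigma> *\<^sub>R s i\<close>, so that the two
  lines yield different edges.\<close>
lemma hull_edge_exists:
  assumes "i \<in> {1..n}" "\<sigma> \<in> {1, -1 :: real}"
  shows "\<exists>u v c. hull_edge i u v \<and> v - u = c *\<^sub>R s i \<and> \<sigma> * c > 0"
proof -
  define \<phi> where "\<phi> x = \<sigma> * cross2 (s i) x" for x
  have "V \<noteq> {}" using card_V n_ge_2 by auto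
  then obtain p where p: "p \<in> V" "\<And>w. w \<in> V \<Longrightarrow> \<phi> p \<le> \<phi> w"
    using finite_V ex_min_if_finite[of "\<phi> ` V"] by (metis (no_types, lifting) arg_min_if_finite(1) arg_min_least)
  obtain q where q: "q \<in> V" "q \<noteq> p" "cross2 (s i) (q - p) = 0"
    using match[OF assms(1) p(1)] by blast
  obtain c where c: "q - p = c *\<^sub>R s i"
    using cross2_eq_0_imp_scaleR[OF q(3) s_nonzero[OF assms(1)]] by blast
  then have "c \<noteq> 0" using q(2) by auto
  have low: "0 \<le> \<sigma> * cross2 (s i) (w - p)" if "w \<in> V" for w
    using p(2)[OF that] unfolding \<phi>_def by (simp add: algebra_simps)
  have sq: "cross2 (s i) q = cross2 (s i) p" using q(3) by simp
  have \<sigma>: "\<sigma> * \<sigma> = 1" using assms(2) by auto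
  consider "\<sigma> * c > 0" | "\<sigma> * (- c) > 0"
    using \<open>c \<noteq> 0\<close> \<sigma> by (metis linorder_neqE_linordered_idom mult_eq_0_iff mult_minus_right neg_0_less_iff_less zero_neq_one)
  then show ?thesis
  proof cases
    case 1
    have "0 \<le> cross2 (q - p) (w - p)" if "w \<in> V" for w
    proof -
      have "cross2 (q - p) (w - p) = (\<sigma> * \<sigma>) * (c * cross2 (s i) (w - p))"
        unfolding c \<sigma> by (simp add: right_diff_distrib)
      also have "\<dots> = (\<sigma> * c) * (\<sigma> * cross2 (s i) (w - p))" by (simp only: mult_ac)
      finally have "cross2 (q - p) (w - p) = (\<sigma> * c) * (\<sigma> * cross2 (s i) (w - p))" .
      then show ?thesis using 1 low[OF that] by simp
    qed
    then have "hull_edge i p q" using assms(1) p(1) q unfolding hull_edge_def by blast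
    then show ?thesis using c 1 by blast
  next
    case 2
    have c': "p - q = (- c) *\<^sub>R s i" using c by (simp add: algebra_simps)
    have "0 \<le> cross2 (p - q) (w - q)" if "w \<in> V" for w
    proof -
      have "cross2 (p - q) (w - q) = (\<sigma> * \<sigma>) * ((- c) * cross2 (s i) (w - p))"
        unfolding c' \<sigma> by (simp add: sq right_diff_distrib)
      also have "\<dots> = (\<sigma> * (- c)) * (\<sigma> * cross2 (s i) (w - p))" by (simp only: mult_ac)
      finally show ?thesis
        using mult_nonneg_nonneg[OF less_imp_le[OF 2] low[OF that]] by (simp only:)
    qed
    moreover have "cross2 (s i) (p - q) = 0" using sq by simp
    ultimately have "hull_edge i q p" using assms(1) p(1) q unfolding hull_edge_def by blast
    then show ?thesis using c' 2 by blast
  qed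
qed

text \<open>The \<open>2 n\<close> choices of a direction and a sign give \<open>2 n\<close> hull edges. Both their sources and their
  targets are pairwise distinct, so they exhaust the \<open>2 n\<close> points of \<open>V\<close>.\<close>
lemma hull_edge_from_and_to:
  assumes "x \<in> V"
  shows "\<exists>i v. hull_edge i x v" "\<exists>i u. hull_edge i u x"
proof -
  define A where "A = {1..n} \<times> {1, -1 :: real}"
  have "\<forall>a\<in>A. \<exists>u v. \<exists>c. hull_edge (fst a) u v \<and> v - u = c *\<^sub>R s (fst a) \<and> snd a * c > 0"
    unfolding A_def using hull_edge_exists by force
  then obtain P Q where PQ: "\<And>a. a \<in> A \<Longrightarrow>
      \<exists>c. hull_edge (fst a) (P a) (Q a) \<and> Q a - P a = c *\<^sub>R s (fst a) \<and> snd a * c > 0"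
    by metis
  have cardA: "card A = card V" unfolding A_def card_V by (simp add: card_cartesian_product)
  have same: "a = b" if ab: "a \<in> A" "b \<in> A" "fst a = fst b" "P a = P b" "Q a = Q b" for a b
  proof -
    obtain c where c: "Q a - P a = c *\<^sub>R s (fst a)" "snd a * c > 0" using PQ[OF ab(1)] by blast
    obtain d where d: "Q b - P b = d *\<^sub>R s (fst b)" "snd b * d > 0" using PQ[OF ab(2)] by blast
    have "fst a \<in> {1..n}" using that(1) by (auto simp: A_def)
    then have "c = d" using c(1) d(1) that s_nonzero by (metis scaleR_cancel_right)
    moreover have "snd a \<in> {1, -1}" "snd b \<in> {1, -1}" using that by (auto simp: A_def)
    ultimately have "snd a = snd b" using c(2) d(2) by auto
    then show ?thesis using that(3) by (simp add: prod_eq_iff)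
  qed
  have "inj_on P A"
  proof (rule inj_onI)
    fix a b assume ab: "a \<in> A" "b \<in> A" "P a = P b"
    then have "fst a = fst b \<and> Q a = Q b" using PQ hull_edge_source_unique by metis
    then show "a = b" using same ab by blast
  qed
  moreover have "P ` A \<subseteq> V" using PQ hull_edgeD(2) by blast
  ultimately have "P ` A = V" using cardA card_image card_subset_eq finite_V by metis
  then show "\<exists>i v. hull_edge i x v" using PQ assms by blast
  have "inj_on Q A"
  proof (rule inj_onI)
    fix a b assume ab: "a \<in> A" "b \<in> A" "Q a = Q b"
    then have "fst a = fst b \<and> P a = P b" using PQ hull_edge_target_unique by metis
    then show "a = b" using same ab by blast
  qed
  moreover have "Q ` A \<subseteq> V" using PQ hull_edgeD(3) by blast
  ultimately have "Q ` A = V" using cardA card_image card_subset_eq finite_V by metis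
  then show "\<exists>i u. hull_edge i u x" using PQ assms by blast
qed

text \<open>\<open>V\<close> lies in the cone at \<open>p\<close> that is spanned by the two edges at \<open>p\<close>. Hence a linear function
  that decreases towards some point of \<open>V\<close> decreases along one of these edges.\<close>
lemma lower_neighbour:
  assumes ap: "hull_edge i a p" and pb: "hull_edge j p b"
    and w: "w \<in> V" "cross2 d w < cross2 d p"
  shows "cross2 d a < cross2 d p \<or> cross2 d b < cross2 d p"
proof (rule ccontr)
  assume neg: "\<not> ?thesis"
  define e f where "e = p - a" and "f = b - p"
  have e_w: "0 \<le> cross2 e (x - p)" if "x \<in> V" for x
    using hull_edgeD(6)[OF ap that] by (simp add: e_def cross2_def algebra_simps)
  have f_w: "0 \<le> cross2 f (x - p)" if "x \<in> V" for x
    using hull_edgeD(6)[OF pb that] by (simp add: f_def)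
  have "cross2 e f \<noteq> 0"
  proof
    assume 0: "cross2 e f = 0"
    then have ij: "i = j" using hull_edge_same_direction[OF ap pb] by (simp add: e_def f_def)
    have "cross2 (s i) (a - p) = 0" using hull_edgeD(5)[OF ap] by simp
    then have ab: "a = b"
      using match_unique[of i p a b] hull_edgeD[OF ap] hull_edgeD[OF pb] ij by metis
    have "V \<subseteq> {a, p}"
    proof
      fix x assume x: "x \<in> V"
      have "cross2 e (x - p) = - cross2 f (x - p)" using ab by (simp add: e_def f_def)
      then have "cross2 e (x - p) = 0" using e_w[OF x] f_w[OF x] by linarith
      then have "cross2 (s i) (x - p) = 0"
        unfolding e_def using hull_edge_parallel_iff[OF ap] by blast
      then show "x \<in> {a, p}"
        using match_unique[of i p x a] x hull_edgeD[OF ap] \<open>cross2 (s i) (a - p) = 0\<close> by blast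
    qed
    then have "card V \<le> card {a, p}" by (intro card_mono) auto
    moreover have "card {a, p} \<le> 2" by (simp add: card_insert_if)
    ultimately show False using card_V n_ge_2 by simp
  qed
  moreover have "0 \<le> cross2 e f" using e_w[OF hull_edgeD(3)[OF pb]] by (simp add: f_def)
  ultimately have D: "cross2 e f > 0" by simp
  have "cross2 e f * cross2 d (w - p) = cross2 d (cross2 e f *\<^sub>R (w - p))" by simp
  also have "\<dots> = - cross2 f (w - p) * cross2 d e + cross2 e (w - p) * cross2 d f"
    unfolding cross2_expand[of e f "w - p"] cross2_commute[of f "w - p"] cross2_simps(3,6) by simp
  also have "\<dots> \<ge> 0"
  proof -
    have "cross2 d e \<le> 0" "cross2 d f \<ge> 0" using neg by (simp_all add: e_def f_def)
    then show ?thesis using e_w[OF w(1)] f_w[OF w(1)]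
      by (meson add_nonneg_nonneg mult_nonneg_nonneg mult_nonpos_nonpos neg_le_0_iff_le)
  qed
  finally have "cross2 d (w - p) \<ge> 0" using D by (simp add: zero_le_mult_iff)
  then show False using w(2) by simp
qed

definition hull_walk :: "(nat \<Rightarrow> real ^ 2) \<Rightarrow> bool" where
  "hull_walk v \<longleftrightarrow> (\<forall>k. \<exists>i. hull_edge i (v k) (v (Suc k)))"

lemma hull_walk_exists: "\<exists>v. hull_walk v"
proof -
  have "V \<noteq> {}" using card_V n_ge_2 by auto
  then obtain v where "\<And>k. v k \<in> V" "\<And>k. \<exists>i. hull_edge i (v k) (v (Suc k))"
    using dependent_nat_choice[of "\<lambda>_ x. x \<in> V" "\<lambda>_ x y. \<exists>i. hull_edge i x y"]
    by (metis (mono_tags, lifting) all_not_in_conv hull_edgeD(3) hull_edge_from_and_to(1))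
  then show ?thesis unfolding hull_walk_def by blast
qed

lemma hull_walk_in_V: "hull_walk v \<Longrightarrow> v k \<in> V"
  unfolding hull_walk_def using hull_edgeD(2) by blast

definition step :: "(nat \<Rightarrow> real ^ 2) \<Rightarrow> nat \<Rightarrow> real ^ 2" where
  "step v k = v (Suc k) - v k"

lemma step_nonzero: "hull_walk v \<Longrightarrow> step v k \<noteq> 0"
  unfolding hull_walk_def step_def using hull_edgeD(4) by (metis right_minus_eq)

lemma step_match_unique:
  assumes "hull_walk v" "p \<in> V" "x \<in> V" "y \<in> V" "x \<noteq> p" "y \<noteq> p"
    "cross2 (step v i) x = cross2 (step v i) p" "cross2 (step v i) y = cross2 (step v i) p"
  shows "x = y"
proof -
  obtain j where j: "hull_edge j (v i) (v (Suc i))" using assms(1) unfolding hull_walk_def by blast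
  have "cross2 (s j) (x - p) = 0" "cross2 (s j) (y - p) = 0"
    using hull_edge_parallel_iff[OF j] assms(7,8) unfolding step_def
    by (metis cross2_simps(4) diff_self)+
  then show ?thesis using match_unique hull_edgeD(1)[OF j] assms by blast
qed

lemma step_match_exists:
  assumes "hull_walk v" "p \<in> V"
  shows "\<exists>q\<in>V. q \<noteq> p \<and> cross2 (step v i) q = cross2 (step v i) p"
proof -
  obtain j where j: "hull_edge j (v i) (v (Suc i))" using assms(1) unfolding hull_walk_def by blast
  obtain q where q: "q \<in> V" "q \<noteq> p" "cross2 (s j) (q - p) = 0"
    using match[OF hull_edgeD(1)[OF j] assms(2)] by blast
  then have "cross2 (step v i) (q - p) = 0"
    using hull_edge_parallel_iff[OF j] unfolding step_def by blast
  then show ?thesis using q by auto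
qed

text \<open>The window of vertices from \<open>v (i - k)\<close> to \<open>v (i + k + 1)\<close> is strictly closer to the line of the
  edge number \<open>i\<close> than all other points, and its two end points are equally far. In the step from
  \<open>k\<close> to \<open>k + 1\<close>, consider a point outside the window at the smallest distance, and its partner, which
  is outside as well. Each of the two has a neighbour on the polygon that is closer to the edge,
  hence in the window; so they are the two points that extend the window at its ends. The
  bound \<open>k < n\<close> is the range in which the window has not wrapped around.\<close>
lemma hull_walk_levels:
  assumes v: "hull_walk v" and "k < n" "k \<le> i"
  shows "inj_on v {i - k..i + k + 1}
    \<and> cross2 (step v i) (v (i + k + 1)) = cross2 (step v i) (v (i - k))
    \<and> (\<forall>x\<in>{i - k..i + k + 1}. \<forall>w\<in>V - v ` {i - k..i + k + 1}.
          cross2 (step v i) (v x) < cross2 (step v i) w)"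
  using assms(2,3)
proof (induction k)
  case 0
  obtain j where j: "hull_edge j (v i) (v (Suc i))" using v unfolding hull_walk_def by blast
  have W: "{i..Suc i} = {i, Suc i}" by auto
  have eq: "cross2 (step v i) (v (Suc i)) = cross2 (step v i) (v i)"
    by (simp add: step_def cross2_def algebra_simps)
  have "cross2 (step v i) (v i) < cross2 (step v i) w" if "w \<in> V" "w \<noteq> v i" "w \<noteq> v (Suc i)" for w
  proof -
    have "cross2 (step v i) (v i) \<le> cross2 (step v i) w"
      using hull_edgeD(6)[OF j that(1)] unfolding step_def by simp
    moreover have "cross2 (step v i) w \<noteq> cross2 (step v i) (v i)"
      using step_match_unique[OF v, of "v i" w "v (Suc i)" i] that eq hull_edgeD[OF j] by metis
    ultimately show ?thesis by simp
  qed
  then show ?case using eq hull_edgeD(4)[OF j] by (auto simp: W)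
next
  case (Suc k)
  define \<phi> where "\<phi> = cross2 (step v i)"
  define W where "W = v ` {i - k..i + k + 1}"
  have IH: "inj_on v {i - k..i + k + 1}" "\<And>x w. x \<in> W \<Longrightarrow> w \<in> V - W \<Longrightarrow> \<phi> x < \<phi> w"
    using Suc unfolding \<phi>_def W_def by auto
  have vV: "v l \<in> V" for l using v hull_walk_in_V by blast
  have "card W \<le> 2 * k + 2"
    unfolding W_def using card_image_le[of "{i - k..i + k + 1}" v] Suc.prems by simp
  then have "\<not> V \<subseteq> W" using card_mono[of W V] card_V Suc.prems by (auto simp: W_def)
  then have "V - W \<noteq> {}" by blast
  then obtain p where p: "p \<in> V - W" "\<And>w. w \<in> V - W \<Longrightarrow> \<phi> p \<le> \<phi> w"
    using finite_V by (metis (no_types, lifting) arg_min_if_finite(1) arg_min_least finite_Diff)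
  have viW: "v i \<in> W" unfolding W_def by simp
  obtain q where q: "q \<in> V" "q \<noteq> p" "\<phi> q = \<phi> p"
    using step_match_exists[OF v, of p i] p(1) unfolding \<phi>_def by auto
  have qW: "q \<notin> W" using IH(2)[of q p] p(1) q by auto
  \<comment> \<open>Every point on the next level is a polygon neighbour of the window.\<close>
  have outer: "x = v (i - Suc k) \<or> x = v (i + k + 2)" if x: "x \<in> V - W" "\<phi> x = \<phi> p" for x
  proof -
    obtain l r a b where ab: "hull_edge l a x" "hull_edge r x b"
      using hull_edge_from_and_to x by blast
    have "\<phi> (v i) < \<phi> x" using IH(2)[OF viW x(1)] .
    then have "\<phi> a < \<phi> x \<or> \<phi> b < \<phi> x"
      using lower_neighbour[OF ab vV] unfolding \<phi>_def by blast
    moreover have "y \<in> W" if "y \<in> V" "\<phi> y < \<phi> x" for y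
      using p(2)[of y] x(2) that by force
    ultimately have "a \<in> W \<or> b \<in> W"
      using hull_edgeD(2)[OF ab(1)] hull_edgeD(3)[OF ab(2)] by blast
    then show ?thesis
    proof
      assume "a \<in> W"
      then obtain h where h: "h \<in> {i - k..i + k + 1}" "a = v h" unfolding W_def by blast
      have xh: "x = v (Suc h)"
        using v ab(1) h(2) hull_edge_source_unique unfolding hull_walk_def by blast
      then have "Suc h \<notin> {i - k..i + k + 1}" using x(1) unfolding W_def by blast
      then have "Suc h = i + k + 2" using h(1) by auto
      then show ?thesis using xh by simp
    next
      assume "b \<in> W"
      then obtain h where h: "h \<in> {i - k..i + k + 1}" "b = v h" unfolding W_def by blast
      have hp: "h = Suc (h - 1)" using h(1) Suc.prems by auto
      then have xh: "x = v (h - 1)"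
        using v ab(2) h(2) hull_edge_target_unique unfolding hull_walk_def by metis
      then have "h - 1 \<notin> {i - k..i + k + 1}" using x(1) unfolding W_def by blast
      then have "h - 1 = i - Suc k" using h(1) by auto
      then show ?thesis using xh by simp
    qed
  qed
  have pq: "{p, q} = {v (i - Suc k), v (i + k + 2)}"
    using outer[of p] outer[of q] p(1) q qW by auto
  have win: "{i - Suc k..i + Suc k + 1} = insert (i - Suc k) (insert (i + k + 2) {i - k..i + k + 1})"
    using Suc.prems by auto
  have img: "v ` {i - Suc k..i + Suc k + 1} = {p, q} \<union> W"
    unfolding win pq W_def by simp
  have pqout: "{v (i - Suc k), v (i + k + 2)} \<inter> W = {}" "v (i - Suc k) \<noteq> v (i + k + 2)"
    using pq p(1) q qW by auto
  have "inj_on v {i - Suc k..i + Suc k + 1}"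
    unfolding win using IH(1) pqout unfolding W_def by (auto simp: inj_on_insert)
  moreover have "\<phi> (v (i + Suc k + 1)) = \<phi> (v (i - Suc k))"
    using pq q(3) by (auto simp: doubleton_eq_iff)
  moreover have "\<phi> x < \<phi> w" if "x \<in> {p, q} \<union> W" "w \<in> V - ({p, q} \<union> W)" for x w
  proof -
    have "\<phi> w \<noteq> \<phi> p" using outer[of w] that(2) pq by blast
    then have "\<phi> p < \<phi> w" using p(2)[of w] that(2) by force
    then show ?thesis using that IH(2)[of x w] q(3) by auto
  qed
  ultimately show ?case unfolding \<phi>_def[symmetric] using img by blast
qed

lemma step_parallel_chord:
  assumes "hull_walk v" "k < n" "k \<le> i"
  shows "cross2 (step v i) (v (i + k + 1) - v (i - k)) = 0"
  using hull_walk_levels[OF assms] by simp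

text \<open>The vertex \<open>v (i + r)\<close> is in the window for \<open>k = r - 1\<close> and \<open>v (i + r + 1)\<close> is not, so the step
  between them moves away from the edge number \<open>i\<close>.\<close>
lemma step_not_parallel:
  assumes v: "hull_walk v" and r: "0 < r" "r < n" "r \<le> i"
  shows "cross2 (step v i) (step v (i + r)) \<noteq> 0"
proof -
  let ?W = "{i - (r - 1)..i + (r - 1) + 1}"
  have low: "\<forall>x\<in>?W. \<forall>w\<in>V - v ` ?W. cross2 (step v i) (v x) < cross2 (step v i) w"
    using hull_walk_levels[OF v, of "r - 1" i] r by auto
  have inj: "inj_on v {i - r..i + r + 1}" using hull_walk_levels[OF v, of r i] r by auto
  have "v (Suc (i + r)) \<notin> v ` ?W"
  proof
    assume "v (Suc (i + r)) \<in> v ` ?W"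
    then obtain l where l: "l \<in> ?W" "v (Suc (i + r)) = v l" by blast
    have "Suc (i + r) = l" by (rule inj_onD[OF inj l(2)]) (use l(1) r in auto)
    then show False using l(1) r by auto
  qed
  then have "cross2 (step v i) (v (i + r)) < cross2 (step v i) (v (Suc (i + r)))"
    using low r hull_walk_in_V[OF v] by auto
  then show ?thesis by (simp add: step_def)
qed

text \<open>\<open>2 n\<close> consecutive vertices exhaust \<open>V\<close>, so the next vertex is one of them; since predecessors
  are unique, it can only be the first.\<close>
lemma hull_walk_periodic:
  assumes v: "hull_walk v"
  shows "v (j + 2 * n) = v j"
proof -
  have "{j + (n - 1) - (n - 1)..j + (n - 1) + (n - 1) + 1} = {j..<j + 2 * n}"
    using n_ge_2 by auto
  then have inj: "inj_on v {j..<j + 2 * n}"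
    using hull_walk_levels[OF v, of "n - 1" "j + (n - 1)"] n_ge_2 by auto
  then have "card (v ` {j..<j + 2 * n}) = card V" using card_V by (simp add: card_image)
  then have "v ` {j..<j + 2 * n} = V"
    using finite_V hull_walk_in_V[OF v] by (intro card_subset_eq) auto
  then obtain l where l: "l \<in> {j..<j + 2 * n}" "v (j + 2 * n) = v l"
    using hull_walk_in_V[OF v] by (metis imageE)
  have "l = j"
  proof (rule ccontr)
    assume "l \<noteq> j"
    then have "l = Suc (l - 1)" "j + 2 * n = Suc (j + 2 * n - 1)" using l n_ge_2 by auto
    then have "v (l - 1) = v (j + 2 * n - 1)"
      using v l(2) hull_edge_target_unique unfolding hull_walk_def by metis
    then have "l - 1 = j + 2 * n - 1"
      using inj l \<open>l \<noteq> j\<close> n_ge_2 by (auto dest!: inj_onD)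
    then show False using l \<open>l \<noteq> j\<close> by auto
  qed
  then show ?thesis using l by simp
qed

text \<open>The chord for \<open>k = 1\<close> says that \<open>e (h + 2) + e h = \<mu> h *\<^sub>R e (h + 1)\<close> for some \<open>\<mu> h\<close>. The chord
  for \<open>k = 2\<close> says that \<open>\<mu> h\<close> depends only on the parity of \<open>h\<close>. Adding two neighbouring
  instances of the first relation eliminates the steps of one parity, with
  \<open>t = \<mu> 1 * \<mu> 0 - 2\<close>.\<close>
lemma step_recurrence:
  assumes v: "hull_walk v" and n: "3 \<le> n"
  shows "\<exists>t. \<forall>i\<ge>2. step v (i + 2) = t *\<^sub>R step v i - step v (i - 2)"
proof -
  define e where "e = step v"
  have ve: "v (Suc k) = v k + e k" for k by (simp add: e_def step_def)
  have "\<exists>\<mu>. e (h + 2) + e h = \<mu> *\<^sub>R e (h + 1)" for h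
  proof -
    have "cross2 (e (h + 1)) (v (h + 1 + 1 + 1) - v (h + 1 - 1)) = 0"
      unfolding e_def by (rule step_parallel_chord[OF v]) (use n in auto)
    then have "cross2 (e (h + 1)) (e (h + 2) + e h) = 0" by (simp add: ve)
    moreover have "e (h + 1) \<noteq> 0" unfolding e_def by (rule step_nonzero[OF v])
    ultimately show ?thesis by (rule cross2_eq_0_imp_scaleR)
  qed
  then obtain \<mu> where \<mu>: "\<And>h. e (h + 2) + e h = \<mu> h *\<^sub>R e (h + 1)" by metis
  have alt: "\<mu> (h + 2) = \<mu> h" for h
  proof -
    define X where "X = cross2 (e (h + 2)) (e (h + 1))"
    have e3: "e (h + 3) = \<mu> (h + 1) *\<^sub>R e (h + 2) - e (h + 1)"
      using \<mu>[of "h + 1"] by (simp add: eval_nat_numeral algebra_simps)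
    then have X3: "cross2 (e (h + 2)) (e (h + 3)) = - X" by (simp add: X_def)
    have e4: "e (h + 4) + e (h + 2) = \<mu> (h + 2) *\<^sub>R e (h + 3)"
      using \<mu>[of "h + 2"] by (simp add: eval_nat_numeral)
    have "cross2 (e (h + 2)) (v (h + 2 + 2 + 1) - v (h + 2 - 2)) = 0"
      unfolding e_def by (rule step_parallel_chord[OF v]) (use n in auto)
    also have "v (h + 2 + 2 + 1) - v (h + 2 - 2)
        = (e (h + 2) + e h) + (e (h + 4) + e (h + 2)) + (e (h + 1) + e (h + 3) - e (h + 2))"
      by (simp add: ve eval_nat_numeral)
    finally have "\<mu> h * X + \<mu> (h + 2) * (- X) + (X + (- X) - 0) = 0"
      unfolding \<mu>[of h] e4 cross2_simps X3 X_def[symmetric] .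
    then have "(\<mu> h - \<mu> (h + 2)) * X = 0" unfolding left_diff_distrib by linarith
    moreover have "cross2 (e (h + 1)) (e (h + 1 + 1)) \<noteq> 0"
      unfolding e_def by (rule step_not_parallel[OF v]) (use n in auto)
    ultimately show ?thesis
      unfolding X_def using cross2_commute[of "e (h + 1)" "e (h + 2)"] by simp
  qed
  have prod: "\<mu> (Suc h) * \<mu> h = \<mu> 1 * \<mu> 0" for h
  proof (induction h)
    case (Suc h) then show ?case using alt[of h] by (simp add: mult.commute)
  qed simp
  have "e (i + 2) = (\<mu> 1 * \<mu> 0 - 2) *\<^sub>R e i - e (i - 2)" if "2 \<le> i" for i
  proof -
    define h where "h = i - 2"
    have i: "i = h + 2" using that by (simp add: h_def)
    have "e (h + 4) = \<mu> (h + 2) *\<^sub>R e (h + 3) - e (h + 2)"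
      using \<mu>[of "h + 2"] by (simp add: eval_nat_numeral algebra_simps)
    moreover have "e (h + 3) = \<mu> (h + 1) *\<^sub>R e (h + 2) - e (h + 1)"
      using \<mu>[of "h + 1"] by (simp add: eval_nat_numeral algebra_simps)
    ultimately have "e (h + 4) = (\<mu> (h + 1) * \<mu> h) *\<^sub>R e (h + 2) - \<mu> h *\<^sub>R e (h + 1) - e (h + 2)"
      unfolding alt by (simp add: scaleR_right_diff_distrib mult.commute)
    also have "\<dots> = (\<mu> 1 * \<mu> 0) *\<^sub>R e (h + 2) - (e (h + 2) + e h) - e (h + 2)"
      using prod[of h] \<mu>[of h] by simp
    also have "\<dots> = (\<mu> 1 * \<mu> 0 - 2) *\<^sub>R e (h + 2) - e h"
      by (simp add: scaleR_left_diff_distrib scaleR_2)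
    finally show ?thesis unfolding i by (simp add: eval_nat_numeral)
  qed
  then show ?thesis unfolding e_def by blast
qed

text \<open>Every second step of the walk satisfies the recurrence with constant \<open>t\<close>, and its cross product
  with a fixed step is an integer from a finite set. So some steps at distance \<open>4\<close> or \<open>6\<close> are
  parallel, which \<open>step_not_parallel\<close> excludes. The fixed step is number \<open>n\<close> instead of \<open>0\<close> because
  \<open>step_not_parallel\<close> also looks back along the walk.\<close>
lemma lattice_imp_small:
  assumes lattice: "V \<subseteq> int_lattice"
  shows "n \<in> {2, 3, 4, 6}"
proof (rule ccontr)
  assume "\<not> ?thesis"
  then have n: "n = 5 \<or> n > 6" using n_ge_2 by auto
  obtain v where v: "hull_walk v" using hull_walk_exists by blast
  obtain t where t: "\<And>i. 2 \<le> i \<Longrightarrow> step v (i + 2) = t *\<^sub>R step v i - step v (i - 2)"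
    using step_recurrence[OF v] n by fastforce
  have vV: "v k \<in> V" for k using hull_walk_in_V[OF v] .
  define x where "x j = step v (n + 2 * j)" for j
  define c where "c j = \<lfloor>cross2 (x 0) (x j)\<rfloor>" for j
  have c: "real_of_int (c j) = cross2 (x 0) (x j)" for j
  proof -
    have "cross2 (x 0) (x j) \<in> \<int>"
      unfolding x_def step_def using vV lattice by (intro cross2_int_lattice_diff) auto
    then show ?thesis unfolding c_def by (simp add: of_int_floor)
  qed
  have "real_of_int (c (j + 2)) = t * c (j + 1) - c j" for j
  proof -
    have "x (j + 2) = t *\<^sub>R x (j + 1) - x j"
      using t[of "n + 2 * (j + 1)"] unfolding x_def by (simp add: algebra_simps)
    then show ?thesis by (simp add: c)
  qed
  moreover have "c 0 = 0" using c[of 0] by simp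
  moreover have "c 1 \<noteq> 0"
    using c[of 1] step_not_parallel[OF v, of 2 n] n unfolding x_def by auto
  moreover have "finite (range c)"
  proof -
    have "range c \<subseteq> (\<lambda>(a, b). \<lfloor>cross2 (x 0) (a - b)\<rfloor>) ` (V \<times> V)"
      unfolding c_def x_def step_def using vV by auto
    then show ?thesis using finite_V by (meson finite_SigmaI finite_imageI finite_subset)
  qed
  ultimately have "c 2 = 0 \<or> c 3 = 0" by (rule bounded_int_recurrence)
  then have "cross2 (step v n) (step v (n + 4)) = 0 \<or> cross2 (step v n) (step v (n + 6)) = 0"
    using c[of 2] c[of 3] unfolding x_def by auto
  moreover have "cross2 (step v n) (step v (n + 4)) \<noteq> 0"
    using step_not_parallel[OF v, of 4 n] n by auto
  moreover have "cross2 (step v n) (step v (n + 6)) \<noteq> 0"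
  proof (cases "n = 5")
    case True
    \<comment> \<open>The walk has period \<open>10\<close>, and a distance of \<open>6\<close> becomes a distance of \<open>4\<close> the other way round.\<close>
    have "step v (n + 10) = step v n"
      using hull_walk_periodic[OF v, of n] hull_walk_periodic[OF v, of "Suc n"] True
      by (simp add: step_def)
    then show ?thesis
      using step_not_parallel[OF v, of 4 "n + 6"] True cross2_commute[of "step v n"] by simp
  next
    case False
    then show ?thesis using step_not_parallel[OF v, of 6 n] n by auto
  qed
  ultimately show False by blast
qed

end

section \<open>From equal X-rays to perfect matchings\<close>

lemma xray_eq_imp_card_eq:
  assumes "direction s" "xray s F = xray s F'"
  shows "card {x \<in> F. cross2 s (x - p) = 0} = card {x \<in> F'. cross2 s (x - p) = 0}"
proof -
  define L where "L = {p + c *\<^sub>R s | c. c \<in> (UNIV :: real set)}"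
  have L: "x \<in> L \<longleftrightarrow> cross2 s (x - p) = 0" for x
  proof
    assume "cross2 s (x - p) = 0"
    then obtain c where "x - p = c *\<^sub>R s"
      using cross2_eq_0_imp_scaleR assms(1) unfolding direction_def by blast
    then have "x = p + c *\<^sub>R s" by (metis add.commute diff_add_cancel)
    then show "x \<in> L" unfolding L_def by blast
  qed (auto simp: L_def)
  have "L \<in> lines_parallel_to s" unfolding lines_parallel_to_def L_def by blast
  then have "card (F \<inter> L) = card (F' \<inter> L)"
    using fun_cong[OF assms(2), of L] unfolding xray_def by simp
  moreover have "G \<inter> L = {x \<in> G. cross2 s (x - p) = 0}" for G using L by blast
  ultimately show ?thesis by simp
qed

lemma opposite_point_inj:
  assumes cross: "\<And>i j. i \<in> I \<Longrightarrow> j \<in> I \<Longrightarrow> i \<noteq> j \<Longrightarrow> cross2 (s i) (s j) \<noteq> 0"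
    and \<pi>: "\<And>i. i \<in> I \<Longrightarrow> \<pi> i \<noteq> p \<and> cross2 (s i) (\<pi> i - p) = 0"
  shows "inj_on \<pi> I"
proof (rule inj_onI, rule ccontr)
  fix i j assume ij: "i \<in> I" "j \<in> I" "\<pi> i = \<pi> j" "i \<noteq> j"
  have "cross2 (s i) (\<pi> i - p) = 0" "cross2 (\<pi> i - p) (s j) = 0"
    using \<pi>[OF ij(1)] \<pi>[OF ij(2)] ij(3) cross2_commute[of "\<pi> i - p"] by auto
  then show False using cross2_eq_0_trans cross ij \<pi>[OF ij(1)] by fastforce
qed

lemma missing_point_opposite:
  assumes "direction s" "xray s F = xray s F'" "finite F" "p \<in> F - F'"
  shows "\<exists>q\<in>F' - F. cross2 s (q - p) = 0"
proof (rule ccontr)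
  assume "\<not> ?thesis"
  then have "{x \<in> F'. cross2 s (x - p) = 0} \<subset> {x \<in> F. cross2 s (x - p) = 0}"
    using assms(4) by auto
  then have "card {x \<in> F'. cross2 s (x - p) = 0} < card {x \<in> F. cross2 s (x - p) = 0}"
    using assms(3) by (intro psubset_card_mono) auto
  then show False using xray_eq_imp_card_eq[OF assms(1,2), of p] by simp
qed

text \<open>A point other than \<open>p\<close> is seen from \<open>p\<close> in at most one of the directions, so
  \<open>F' - F\<close> has at least as many points as there are directions.\<close>
lemma opposite_points:
  assumes dir: "\<And>i. i \<in> I \<Longrightarrow> direction (s i)"
    and cross: "\<And>i j. i \<in> I \<Longrightarrow> j \<in> I \<Longrightarrow> i \<noteq> j \<Longrightarrow> cross2 (s i) (s j) \<noteq> 0"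
    and xray: "\<And>i. i \<in> I \<Longrightarrow> xray (s i) F = xray (s i) F'"
    and "finite F" and p: "p \<in> F - F'"
  shows "\<exists>\<pi>. inj_on \<pi> I \<and> \<pi> ` I \<subseteq> F' - F \<and> (\<forall>i\<in>I. cross2 (s i) (\<pi> i - p) = 0)"
proof -
  have "\<forall>i\<in>I. \<exists>q. q \<in> F' - F \<and> cross2 (s i) (q - p) = 0"
  proof
    fix i assume "i \<in> I"
    then show "\<exists>q. q \<in> F' - F \<and> cross2 (s i) (q - p) = 0"
      using missing_point_opposite[OF dir xray \<open>finite F\<close> p] by (simp only: Bex_def)
  qed
  then obtain \<pi> where \<pi>: "\<And>i. i \<in> I \<Longrightarrow> \<pi> i \<in> F' - F \<and> cross2 (s i) (\<pi> i - p) = 0"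
    by metis
  moreover have "inj_on \<pi> I"
    by (rule opposite_point_inj[of I s \<pi> p]) (use \<pi> p cross in blast)+
  ultimately show ?thesis by blast
qed

text \<open>With \<open>n\<close> directions and \<open>n\<close> points in \<open>F'\<close>, the opposite points of \<open>v\<close> exhaust \<open>F'\<close>, so every
  line through \<open>v\<close> in one of the directions has exactly one point of \<open>F'\<close>. By equality of the X-rays
  it has exactly one point of \<open>F\<close>, which is \<open>v\<close> itself.\<close>
lemma unique_partner:
  assumes dir: "\<And>i. i \<in> {1..n} \<Longrightarrow> direction (s i)"
    and cross: "\<And>i j. i \<in> {1..n} \<Longrightarrow> j \<in> {1..n} \<Longrightarrow> i \<noteq> j \<Longrightarrow> cross2 (s i) (s j) \<noteq> 0"
    and xray: "\<And>i. i \<in> {1..n} \<Longrightarrow> xray (s i) F = xray (s i) F'"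
    and fin: "finite F" "finite F'" and card: "card F' = n" and disj: "F \<inter> F' = {}"
    and v: "v \<in> F" and i: "i \<in> {1..n}"
  shows "\<exists>!u. u \<in> F \<union> F' \<and> u \<noteq> v \<and> cross2 (s i) (u - v) = 0"
proof -
  have "v \<in> F - F'" using v disj by blast
  from opposite_points[of "{1..n}" s, OF dir cross xray fin(1) this]
  obtain \<pi> where \<pi>: "inj_on \<pi> {1..n}" "\<pi> ` {1..n} \<subseteq> F' - F"
      "\<And>i. i \<in> {1..n} \<Longrightarrow> cross2 (s i) (\<pi> i - v) = 0"
    by blast
  have surj: "\<pi> ` {1..n} = F'"
    using card_image[OF \<pi>(1)] \<pi>(2) card fin(2) by (intro card_subset_eq) auto
  have "q = \<pi> i" if q: "q \<in> F'" "cross2 (s i) (q - v) = 0" for q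
  proof -
    obtain j where j: "j \<in> {1..n}" "q = \<pi> j" using q(1) surj by blast
    have "cross2 (q - v) (s j) = 0"
      using \<pi>(3)[OF j(1)] cross2_commute[of "s j"] j(2) by simp
    moreover have "q - v \<noteq> 0" using q(1) v disj by auto
    ultimately have "cross2 (s i) (s j) = 0" using cross2_eq_0_trans q(2) by blast
    then show ?thesis using cross i j by blast
  qed
  moreover have "\<pi> i \<in> F'" using surj i by blast
  ultimately have line': "{x \<in> F'. cross2 (s i) (x - v) = 0} = {\<pi> i}"
    using \<pi>(3)[OF i] by blast
  then have "card {x \<in> F. cross2 (s i) (x - v) = 0} = 1"
    using xray_eq_imp_card_eq[OF dir[OF i] xray[OF i], of v] by simp
  then obtain a where a: "{x \<in> F. cross2 (s i) (x - v) = 0} = {a}" by (rule card_1_singletonE)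
  have "v \<in> {a}" using v unfolding a[symmetric] by simp
  then have "{x \<in> F. cross2 (s i) (x - v) = 0} = {v}" using a by simp
  then show ?thesis using line' v disj by (intro ex1I[of _ "\<pi> i"]) blast+
qed

theorem corollary2p3:
  fixes n m :: nat
    and s :: "nat \<Rightarrow> real ^ 2"
    and F F' :: "(real ^ 2) set"
  assumes "n = 5 \<or> n > 6"
    and "m \<ge> n"
    and "\<And>i. i \<in> {1..m} \<Longrightarrow> direction (s i)"
    and "\<And>i j. i \<in> {1..m} \<Longrightarrow> j \<in> {1..m} \<Longrightarrow> i \<noteq> j \<Longrightarrow> different_directions (s i) (s j)"
    and "F \<subseteq> int_lattice" and "finite F" and "card F = n"
    and "F' \<subseteq> int_lattice" and "finite F'" and "card F' = n"
    and "\<And>i. i \<in> {1..m} \<Longrightarrow> xray (s i) F = xray (s i) F'"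
  shows "F = F'"
proof (rule ccontr)
  assume "F \<noteq> F'"
  note dir = assms(3) and xray = assms(11)
  have cross: "cross2 (s i) (s j) \<noteq> 0" if "i \<in> {1..m}" "j \<in> {1..m}" "i \<noteq> j" for i j
    using different_directions_imp_cross2 assms(3,4) that by blast
  have "\<not> F \<subseteq> F'" using \<open>F \<noteq> F'\<close> card_subset_eq assms(7,9,10) by metis
  then obtain p where p: "p \<in> F - F'" by blast
  obtain \<pi> where \<pi>: "inj_on \<pi> {1..m}" "\<pi> ` {1..m} \<subseteq> F' - F"
    using opposite_points[of "{1..m}" s, OF dir cross xray assms(6) p] by blast
  have "m \<le> card (F' - F)"
    using card_mono[OF _ \<pi>(2)] card_image[OF \<pi>(1)] assms(9) by simp
  moreover have "card (F' - F) \<le> n" using card_mono[of F' "F' - F"] assms(9,10) by auto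
  ultimately have m: "m = n" and "card (F' - F) = card F'" using assms(2,10) by auto
  then have "F' - F = F'" using assms(9) by (intro card_subset_eq) auto
  then have disj: "F \<inter> F' = {}" by blast
  interpret matched_by_directions "F \<union> F'" n s
  proof
    show "card (F \<union> F') = 2 * n" using disj assms by (simp add: card_Un_disjoint)
    show "\<exists>!u. u \<in> F \<union> F' \<and> u \<noteq> v \<and> cross2 (s i) (u - v) = 0"
      if "i \<in> {1..n}" "v \<in> F \<union> F'" for i v
    proof (cases "v \<in> F")
      case True
      show ?thesis
        by (rule unique_partner[OF dir cross xray]) (use m assms disj True that in auto)
    next
      case False
      have "\<exists>!u. u \<in> F' \<union> F \<and> u \<noteq> v \<and> cross2 (s i) (u - v) = 0"
        by (rule unique_partner[OF dir cross xray[symmetric]]) (use m assms disj False that in auto)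
      then show ?thesis by (simp add: Un_commute)
    qed
  qed (use assms cross m in auto)
  have "n \<in> {2, 3, 4, 6}" using assms(5,8) by (intro lattice_imp_small) auto
  then show False using assms(1) by auto
qed

end
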